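(* Let $m\ge 1$ be a fixed integer. The difference Hilbert sequence spaces $h_c(\Delta^{(m)})$, $h_0(\Delta^{(m)})$ and $h_\infty(\Delta^{(m)})$, each equipped with the norm $\|x\|_\Delta=\sup_{n}|(H\Delta^{(m)}x)_n|$, are isomorphic (as normed spaces) to $c$, $c_0$ and $\ell_\infty$ respectively, where the latter carry the supremum norm: $h_c(\Delta^{(m)})\cong c$, $h_0(\Delta^{(m)})\cong c_0$, $h_\infty(\Delta^{(m)})\cong \ell_\infty$.
   Context: $\omega$ is the space of all complex sequences $x=(x_k)_{k\ge1}$; $\ell_\infty$, $c$, $c_0$ are the spaces of bounded, convergent and null sequences. Put $x_k=0$ for $k\le 0$. The difference operator of order $m$ is $(\Delta^{(m)}x)_k=\sum_{i=0}^m(-1)^i\binom{m}{i}x_{k-i}$. The $H\Delta^{(m)}$-transform of $x\in\omega$ is the sequence $$(H\Delta^{(m)}x)_n=\sum_{k=1}^n\frac{1}{n+k-1}(\Delta^{(m)}x)_k=\sum_{k=1}^{n}\left[\sum_{i=k}^{n}\frac{(-1)^{i-k}}{n+i-1}\binom{m}{i-k}\right]x_k,\qquad n\ge1,$$ i.e. $H$ acts as the lower triangular matrix with entries $\frac1{n+k-1}$ for $1\le k\le n$ and $0$ for $k>n$. The spaces are $h_c(\Delta^{(m)})=\{x\in\omega: H\Delta^{(m)}x\in c\}$, $h_0(\Delta^{(m)})=\{x\in\omega: H\Delta^{(m)}x\in c_0\}$, $h_\infty(\Delta^{(m)})=\{x\in\omega: H\Delta^{(m)}x\in \ell_\infty\}$.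 *)

theory Defs
  imports "HOL-Analysis.Analysis"
begin

text \<open>
  A complex sequence \<open>(x\<^sub>k)\<close> with \<open>k \<ge> 1\<close> is a function \<open>x :: nat \<Rightarrow> complex\<close> whose
  unused value \<open>x 0\<close> is normalised to \<open>0\<close>, so that distinct elements of \<open>seq_omega\<close> are
  distinct sequences.
\<close>

definition seq_omega :: "(nat \<Rightarrow> complex) set" where
  "seq_omega = {x. x 0 = 0}"

definition seq_linf :: "(nat \<Rightarrow> complex) set" where
  "seq_linf = {x \<in> seq_omega. Bseq x}"

definition seq_c :: "(nat \<Rightarrow> complex) set" where
  "seq_c = {x \<in> seq_omega. convergent x}"

definition seq_c0 :: "(nat \<Rightarrow> complex) set" where
  "seq_c0 = {x \<in> seq_omega. x \<longlonglongrightarrow> 0}"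

text \<open>The supremum of a real set is unspecified unless the set is bounded above, so this is
  meaningful for bounded sequences only.\<close>

definition sup_norm :: "(nat \<Rightarrow> complex) \<Rightarrow> real" where
  "sup_norm x = (SUP n\<in>{1..}. norm (x n))"

text \<open>The conditional is the convention \<open>x\<^sub>j = 0\<close> for \<open>j \<le> 0\<close>; subtraction on \<open>nat\<close> truncates.\<close>

definition diff_op :: "nat \<Rightarrow> (nat \<Rightarrow> complex) \<Rightarrow> nat \<Rightarrow> complex" where
  "diff_op m x k =
     (\<Sum>i=0..m. (-1) ^ i * of_nat (m choose i) * (if i < k then x (k - i) else 0))"

text \<open>In the sum \<open>k \<ge> 1\<close>, so the truncated subtraction \<open>n + k - 1\<close> is exact; at \<open>n = 0\<close> the sum
  is empty and the value is \<open>0\<close>.\<close>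

definition hilbert_op :: "(nat \<Rightarrow> complex) \<Rightarrow> nat \<Rightarrow> complex" where
  "hilbert_op x n = (\<Sum>k=1..n. 1 / of_nat (n + k - 1) * x k)"

definition hilbert_diff :: "nat \<Rightarrow> (nat \<Rightarrow> complex) \<Rightarrow> nat \<Rightarrow> complex" where
  "hilbert_diff m x = hilbert_op (diff_op m x)"

definition h_c :: "nat \<Rightarrow> (nat \<Rightarrow> complex) set" where
  "h_c m = {x \<in> seq_omega. hilbert_diff m x \<in> seq_c}"

definition h_0 :: "nat \<Rightarrow> (nat \<Rightarrow> complex) set" where
  "h_0 m = {x \<in> seq_omega. hilbert_diff m x \<in> seq_c0}"

definition h_inf :: "nat \<Rightarrow> (nat \<Rightarrow> complex) set" where
  "h_inf m = {x \<in> seq_omega. hilbert_diff m x \<in> seq_linf}"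

definition diff_norm :: "nat \<Rightarrow> (nat \<Rightarrow> complex) \<Rightarrow> real" where
  "diff_norm m x = sup_norm (hilbert_diff m x)"

text \<open>A complex normed space whose elements are functions with pointwise operations, with an
  explicit carrier \<open>S\<close> and norm \<open>N\<close>.\<close>

definition normed_seq_space :: "(nat \<Rightarrow> complex) set \<Rightarrow> ((nat \<Rightarrow> complex) \<Rightarrow> real) \<Rightarrow> bool" where
  "normed_seq_space S N \<longleftrightarrow>
     (\<lambda>n. 0) \<in> S \<and>
     (\<forall>x\<in>S. \<forall>y\<in>S. (\<lambda>n. x n + y n) \<in> S) \<and>
     (\<forall>a. \<forall>x\<in>S. (\<lambda>n. a * x n) \<in> S) \<and>
     (\<forall>x\<in>S. 0 \<le> N x) \<and>
     (\<forall>x\<in>S. N x = 0 \<longleftrightarrow> x = (\<lambda>n. 0)) \<and>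
     (\<forall>a. \<forall>x\<in>S. N (\<lambda>n. a * x n) = norm a * N x) \<and>
     (\<forall>x\<in>S. \<forall>y\<in>S. N (\<lambda>n. x n + y n) \<le> N x + N y)"

text \<open>Isomorphism of normed spaces: a complex-linear bijection preserving the norm. In particular
  such a map is a linear homeomorphism.\<close>

definition normed_isomorphic ::
  "(nat \<Rightarrow> complex) set \<Rightarrow> ((nat \<Rightarrow> complex) \<Rightarrow> real) \<Rightarrow>
   (nat \<Rightarrow> complex) set \<Rightarrow> ((nat \<Rightarrow> complex) \<Rightarrow> real) \<Rightarrow> bool" where
  "normed_isomorphic S N S' N' \<longleftrightarrow>
     normed_seq_space S N \<and> normed_seq_space S' N' \<and>
     (\<exists>T. bij_betw T S S' \<and>
          (\<forall>x\<in>S. \<forall>y\<in>S. T (\<lambda>n. x n + y n) = (\<lambda>n. T x n + T y n)) \<and>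
          (\<forall>a. \<forall>x\<in>S. T (\<lambda>n. a * x n) = (\<lambda>n. a * T x n)) \<and>
          (\<forall>x\<in>S. N' (T x) = N x))"

end

theory Submission
  imports Defs
begin

text \<open>
  The isomorphism is the map \<open>T = hilbert_diff m\<close> itself. Both the difference operator and the
  operator \<open>H\<close> are given by lower triangular matrices whose diagonal entries (\<open>1\<close>, respectively
  \<open>1 / (2n - 1)\<close>) do not vanish, and forward substitution shows that such a matrix acts
  bijectively on the space of \<^emph>\<open>all\<close> sequences (\<open>bij_betw_triangular\<close>). Hence \<open>T\<close> is a linear
  bijection of \<open>seq_omega\<close>.

  The three difference spaces are the preimages under \<open>T\<close> of \<open>c\<close>, \<open>c\<^sub>0\<close> and \<open>\<ell>\<^sub>\<infinity>\<close>, and their norm is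
  the supremum norm pulled back along \<open>T\<close>. So \<open>T\<close> is isometric by construction, and the norm
  axioms of the preimage are those of its image (\<open>normed_isomorphic_preimage\<close>). It remains to know
  that the supremum norm is a norm on every linear space of bounded sequences
  (\<open>normed_seq_space_sup_norm\<close>).
\<close>

section \<open>Lower triangular matrices acting on sequences\<close>

definition triangular :: "(nat \<Rightarrow> nat \<Rightarrow> complex) \<Rightarrow> (nat \<Rightarrow> complex) \<Rightarrow> nat \<Rightarrow> complex" where
  "triangular a x n = (\<Sum>k=1..n. a n k * x k)"

fun forward_subst :: "(nat \<Rightarrow> nat \<Rightarrow> complex) \<Rightarrow> (nat \<Rightarrow> complex) \<Rightarrow> nat \<Rightarrow> complex" where
  "forward_subst a y n =
     (if n = 0 then 0 else (y n - (\<Sum>k\<in>{1..<n}. a n k * forward_subst a y k)) / a n n)"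

declare forward_subst.simps [simp del]

lemma triangular_split_diagonal:
  assumes "n \<ge> 1"
  shows "triangular a x n = (\<Sum>k\<in>{1..<n}. a n k * x k) + a n n * x n"
proof -
  have "{1..n} = insert n {1..<n}"
    using assms by auto
  then show ?thesis
    by (simp add: triangular_def add.commute)
qed

lemma triangular_in_omega: "triangular a x \<in> seq_omega"
  by (simp add: triangular_def seq_omega_def)

lemma triangular_forward_subst:
  assumes "\<And>n. n \<ge> 1 \<Longrightarrow> a n n \<noteq> 0" and "y \<in> seq_omega"
  shows "triangular a (forward_subst a y) = y"
proof
  fix n
  show "triangular a (forward_subst a y) n = y n"
  proof (cases "n = 0")
    case True
    then show ?thesis
      using assms(2) by (simp add: triangular_def seq_omega_def)
  next
    case False
    then have "n \<ge> 1" and "a n n \<noteq> 0"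
      using assms(1) by simp_all
    have "a n n * forward_subst a y n = y n - (\<Sum>k\<in>{1..<n}. a n k * forward_subst a y k)"
      using False \<open>a n n \<noteq> 0\<close> by (subst forward_subst.simps) simp
    then show ?thesis
      by (simp add: triangular_split_diagonal [OF \<open>n \<ge> 1\<close>])
  qed
qed

lemma forward_subst_triangular:
  assumes "\<And>n. n \<ge> 1 \<Longrightarrow> a n n \<noteq> 0" and "x \<in> seq_omega"
  shows "forward_subst a (triangular a x) = x"
proof
  fix n
  show "forward_subst a (triangular a x) n = x n"
  proof (induction n rule: less_induct)
    case (less n)
    show ?case
    proof (cases "n = 0")
      case True
      then show ?thesis
        using assms(2) by (simp add: forward_subst.simps seq_omega_def)
    next
      case False
      then have "n \<ge> 1" and "a n n \<noteq> 0"
        using assms(1) by simp_all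
      have "(\<Sum>k\<in>{1..<n}. a n k * forward_subst a (triangular a x) k)
          = (\<Sum>k\<in>{1..<n}. a n k * x k)"
        by (rule sum.cong) (simp_all add: less)
      then show ?thesis
        using False \<open>a n n \<noteq> 0\<close>
        by (subst forward_subst.simps) (simp add: triangular_split_diagonal [OF \<open>n \<ge> 1\<close>])
    qed
  qed
qed

lemma bij_betw_triangular:
  assumes "\<And>n. n \<ge> 1 \<Longrightarrow> a n n \<noteq> 0"
  shows "bij_betw (triangular a) seq_omega seq_omega"
  by (rule bij_betwI [where g = "forward_subst a"])
    (auto simp: triangular_in_omega triangular_forward_subst forward_subst_triangular assms,
     simp add: seq_omega_def forward_subst.simps)

section \<open>The transform as a linear bijection\<close>

lemma hilbert_op_eq_triangular: "hilbert_op = triangular (\<lambda>n k. 1 / of_nat (n + k - 1))"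
  by (intro ext) (simp add: hilbert_op_def triangular_def)

text \<open>The substitution \<open>j = k - i\<close> in the defining sum: terms with \<open>i \<ge> k\<close> vanish by the convention
  on nonpositive indices, terms with \<open>i > m\<close> because the binomial coefficient is \<open>0\<close>.\<close>

lemma diff_op_eq_triangular:
  "diff_op m = triangular (\<lambda>k j. (-1) ^ (k - j) * of_nat (m choose (k - j)))"
proof (intro ext)
  fix x k
  show "diff_op m x k = triangular (\<lambda>k j. (-1) ^ (k - j) * of_nat (m choose (k - j))) x k"
    (is "_ = ?rhs")
  proof -
    have "diff_op m x k = (\<Sum>i\<in>{..<k}. (-1) ^ i * of_nat (m choose i) * x (k - i))"
      unfolding diff_op_def by (rule sum.mono_neutral_cong) auto
    also have "\<dots> = ?rhs"
      unfolding triangular_def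
      by (rule sum.reindex_bij_witness [where i = "\<lambda>j. k - j" and j = "\<lambda>i. k - i"]) auto
    finally show ?thesis .
  qed
qed

lemma bij_betw_hilbert_diff: "bij_betw (hilbert_diff m) seq_omega seq_omega"
proof -
  have "bij_betw (diff_op m) seq_omega seq_omega"
    unfolding diff_op_eq_triangular by (rule bij_betw_triangular) simp
  moreover have "bij_betw hilbert_op seq_omega seq_omega"
    unfolding hilbert_op_eq_triangular by (rule bij_betw_triangular) (simp del: of_nat_diff)
  ultimately have "bij_betw (hilbert_op \<circ> diff_op m) seq_omega seq_omega"
    by (rule bij_betw_trans)
  then show ?thesis
    by (simp add: hilbert_diff_def [abs_def] comp_def)
qed

lemma triangular_add: "triangular a (\<lambda>n. x n + y n) = (\<lambda>n. triangular a x n + triangular a y n)"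
  by (intro ext) (simp add: triangular_def sum.distrib algebra_simps)

lemma triangular_scale: "triangular a (\<lambda>n. c * x n) = (\<lambda>n. c * triangular a x n)"
  by (intro ext) (simp add: triangular_def sum_distrib_left algebra_simps)

lemma hilbert_diff_add:
  "hilbert_diff m (\<lambda>n. x n + y n) = (\<lambda>n. hilbert_diff m x n + hilbert_diff m y n)"
  by (simp add: hilbert_diff_def hilbert_op_eq_triangular diff_op_eq_triangular triangular_add)

lemma hilbert_diff_scale: "hilbert_diff m (\<lambda>n. c * x n) = (\<lambda>n. c * hilbert_diff m x n)"
  by (simp add: hilbert_diff_def hilbert_op_eq_triangular diff_op_eq_triangular triangular_scale)

section \<open>The supremum norm\<close>

lemma norm_le_sup_norm:
  assumes "x \<in> seq_linf" and "n \<ge> 1"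
  shows "norm (x n) \<le> sup_norm x"
proof -
  have "Bseq x"
    using assms(1) by (simp add: seq_linf_def)
  then obtain K where "\<And>n. norm (x n) \<le> K"
    by (meson BseqE)
  then have "bdd_above ((\<lambda>n. norm (x n)) ` {1..})"
    by (auto intro!: bdd_aboveI2)
  then show ?thesis
    unfolding sup_norm_def using assms(2) by (intro cSUP_upper) auto
qed

lemma sup_norm_le:
  assumes "\<And>n. n \<ge> 1 \<Longrightarrow> norm (x n) \<le> K"
  shows "sup_norm x \<le> K"
  unfolding sup_norm_def using assms by (intro cSUP_least) auto

lemma sup_norm_nonneg:
  assumes "x \<in> seq_linf"
  shows "0 \<le> sup_norm x"
  using norm_le_sup_norm [OF assms, of 1] by (auto intro: order_trans [OF norm_ge_zero])

lemma sup_norm_eq_0_iff: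
  assumes "x \<in> seq_linf"
  shows "sup_norm x = 0 \<longleftrightarrow> x = (\<lambda>n. 0)"
proof
  assume "sup_norm x = 0"
  then have "x n = 0" if "n \<ge> 1" for n
    using norm_le_sup_norm [OF assms that] by simp
  \<comment> \<open>The supremum does not see the index \<open>0\<close>; there the normalisation of \<open>seq_omega\<close> decides.\<close>
  moreover have "x 0 = 0"
    using assms by (simp add: seq_linf_def seq_omega_def)
  ultimately show "x = (\<lambda>n. 0)"
    by (metis less_one not_le)
qed (simp add: sup_norm_def)

lemma seq_linf_scale:
  assumes "x \<in> seq_linf"
  shows "(\<lambda>n. a * x n) \<in> seq_linf"
  using assms by (auto simp: seq_linf_def seq_omega_def intro: Bseq_mult Bfun_const)

lemma sup_norm_scale_le:
  assumes "x \<in> seq_linf"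
  shows "sup_norm (\<lambda>n. a * x n) \<le> norm a * sup_norm x"
  by (rule sup_norm_le) (simp add: norm_mult mult_left_mono norm_le_sup_norm assms)

text \<open>The reverse inequality is \<open>sup_norm_scale_le\<close> for the inverse scalar.\<close>

lemma sup_norm_scale:
  assumes "x \<in> seq_linf"
  shows "sup_norm (\<lambda>n. a * x n) = norm a * sup_norm x"
proof (cases "a = 0")
  case True
  then show ?thesis
    by (simp add: sup_norm_def)
next
  case False
  have "sup_norm (\<lambda>n. inverse a * (a * x n)) \<le> norm (inverse a) * sup_norm (\<lambda>n. a * x n)"
    by (rule sup_norm_scale_le) (rule seq_linf_scale [OF assms])
  moreover have "(\<lambda>n. inverse a * (a * x n)) = x"
    using False by (simp add: mult.assoc [symmetric])
  ultimately have "norm a * sup_norm x \<le> sup_norm (\<lambda>n. a * x n)"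
    using False by (simp add: norm_divide field_simps)
  with sup_norm_scale_le [OF assms] show ?thesis
    by (rule antisym)
qed

lemma sup_norm_triangle:
  assumes "x \<in> seq_linf" and "y \<in> seq_linf"
  shows "sup_norm (\<lambda>n. x n + y n) \<le> sup_norm x + sup_norm y"
  by (rule sup_norm_le) (intro norm_triangle_mono norm_le_sup_norm assms)

lemma normed_seq_space_sup_norm:
  assumes "V \<subseteq> seq_linf"
    and "(\<lambda>n. 0) \<in> V"
    and "\<And>x y. x \<in> V \<Longrightarrow> y \<in> V \<Longrightarrow> (\<lambda>n. x n + y n) \<in> V"
    and "\<And>a x. x \<in> V \<Longrightarrow> (\<lambda>n. a * x n) \<in> V"
  shows "normed_seq_space V sup_norm"
proof -
  have "x \<in> seq_linf" if "x \<in> V" for x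
    using assms(1) that by blast
  then show ?thesis
    unfolding normed_seq_space_def
    using assms(2-4)
    by (simp add: sup_norm_nonneg sup_norm_eq_0_iff sup_norm_scale sup_norm_triangle)
qed

lemma normed_seq_space_linf: "normed_seq_space seq_linf sup_norm"
proof (rule normed_seq_space_sup_norm)
  show "(\<lambda>n. x n + y n) \<in> seq_linf" if "x \<in> seq_linf" "y \<in> seq_linf" for x y
  proof -
    have "Bseq x" and "Bseq y"
      using that by (simp_all add: seq_linf_def)
    then obtain K L where "\<And>n. norm (x n) \<le> K" and "\<And>n. norm (y n) \<le> L"
      by (meson BseqE)
    then have "Bseq (\<lambda>n. x n + y n)"
      by (intro BseqI' [where K = "K + L"] norm_triangle_mono)
    with that show ?thesis
      by (simp add: seq_linf_def seq_omega_def)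
  qed
qed (simp_all add: seq_linf_scale, simp add: seq_linf_def seq_omega_def)

lemma normed_seq_space_c: "normed_seq_space seq_c sup_norm"
proof (rule normed_seq_space_sup_norm)
  show "seq_c \<subseteq> seq_linf"
    by (auto simp: seq_c_def seq_linf_def convergent_imp_Bseq)
qed (simp_all add: seq_c_def seq_omega_def convergent_const convergent_add
    convergent_mult [OF convergent_const])

lemma normed_seq_space_c0: "normed_seq_space seq_c0 sup_norm"
proof (rule normed_seq_space_sup_norm)
  show "seq_c0 \<subseteq> seq_linf"
    by (auto simp: seq_c0_def seq_linf_def convergent_imp_Bseq convergentI)
qed (simp_all add: seq_c0_def seq_omega_def tendsto_add_zero tendsto_mult_right_zero)

section \<open>Pulling a norm back along a linear bijection\<close>

text \<open>Homogeneity and the triangle inequality pass to the pulled back norm by linearity of \<open>T\<close>;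
  definiteness needs injectivity, and \<open>T\<close> maps the preimage onto \<open>V\<close> because it is surjective.\<close>

lemma normed_isomorphic_preimage:
  assumes V: "normed_seq_space V N" "V \<subseteq> seq_omega"
    and bij: "bij_betw T seq_omega seq_omega"
    and add: "\<And>x y. T (\<lambda>n. x n + y n) = (\<lambda>n. T x n + T y n)"
    and scale: "\<And>a x. T (\<lambda>n. a * x n) = (\<lambda>n. a * T x n)"
  shows "normed_isomorphic {x \<in> seq_omega. T x \<in> V} (\<lambda>x. N (T x)) V N"
proof -
  let ?S = "{x \<in> seq_omega. T x \<in> V}"
  have zero: "T (\<lambda>n. 0) = (\<lambda>n. 0)"
    using scale [of 0 "\<lambda>n. 0"] by simp
  have omega: "(\<lambda>n. 0) \<in> seq_omega"
    "\<And>x y. x \<in> seq_omega \<Longrightarrow> y \<in> seq_omega \<Longrightarrow> (\<lambda>n. x n + y n) \<in> seq_omega"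
    "\<And>a x. x \<in> seq_omega \<Longrightarrow> (\<lambda>n. a * x n) \<in> seq_omega"
    by (simp_all add: seq_omega_def)
  have kernel: "T x = (\<lambda>n. 0) \<longleftrightarrow> x = (\<lambda>n. 0)" if "x \<in> seq_omega" for x
    using bij_betw_imp_inj_on [OF bij] that omega(1) zero by (metis inj_on_eq_iff)
  have "normed_seq_space ?S (\<lambda>x. N (T x))"
    using V(1) unfolding normed_seq_space_def
    by (simp add: add scale zero omega kernel)
  moreover have "bij_betw T ?S V"
  proof (rule bij_betw_imageI)
    show "inj_on T ?S"
      using bij_betw_imp_inj_on [OF bij] by (rule inj_on_subset) blast
    show "T ` ?S = V"
    proof
      show "V \<subseteq> T ` ?S"
      proof
        fix y assume "y \<in> V"
        then have "y \<in> T ` seq_omega"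
          using bij_betw_imp_surj_on [OF bij] V(2) by auto
        with \<open>y \<in> V\<close> show "y \<in> T ` ?S"
          by auto
      qed
    qed auto
  qed
  ultimately show ?thesis
    unfolding normed_isomorphic_def using V(1)
    by (intro conjI exI [of _ T]) (simp_all add: add scale)
qed

lemma normed_isomorphic_hilbert_diff:
  assumes "normed_seq_space V sup_norm" and "V \<subseteq> seq_omega"
  shows "normed_isomorphic {x \<in> seq_omega. hilbert_diff m x \<in> V} (diff_norm m) V sup_norm"
proof -
  have "diff_norm m = (\<lambda>x. sup_norm (hilbert_diff m x))"
    by (simp add: fun_eq_iff diff_norm_def)
  then show ?thesis
    using normed_isomorphic_preimage [OF assms bij_betw_hilbert_diff hilbert_diff_add
        hilbert_diff_scale] by simp
qed

theorem theorem2p1: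
  fixes m :: nat
  assumes "m \<ge> 1"
  shows "normed_isomorphic (h_c m) (diff_norm m) seq_c sup_norm \<and>
         normed_isomorphic (h_0 m) (diff_norm m) seq_c0 sup_norm \<and>
         normed_isomorphic (h_inf m) (diff_norm m) seq_linf sup_norm"
proof (intro conjI)
  show "normed_isomorphic (h_c m) (diff_norm m) seq_c sup_norm"
    unfolding h_c_def
    by (rule normed_isomorphic_hilbert_diff [OF normed_seq_space_c]) (auto simp: seq_c_def)
  show "normed_isomorphic (h_0 m) (diff_norm m) seq_c0 sup_norm"
    unfolding h_0_def
    by (rule normed_isomorphic_hilbert_diff [OF normed_seq_space_c0]) (auto simp: seq_c0_def)
  show "normed_isomorphic (h_inf m) (diff_norm m) seq_linf sup_norm"
    unfolding h_inf_def
    by (rule normed_isomorphic_hilbert_diff [OF normed_seq_space_linf]) (auto simp: seq_linf_def)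
qed

end
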